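(* In Situation 1 or in Situation 2, assume that there exists a Nash equilibrium with incomplete information $\hat c=(\hat a,\hat\alpha,\hat\beta,\hat\gamma,\hat e,\hat m)$ such that the value for firm $I$ is greater than $-p$, and let $$\hat v:=\sup\{v>0:-J(v,\hat c)\le1\}.$$ Then $\hat v>0$, $\hat e=(\varphi')^{-1}\big(\frac1{(1-\hat\beta)^+}\big)$, $\hat\gamma=\frac1{g'(\hat m)}$ and, in Situation 1, $\hat a=(\psi')^{-1}\big(\frac{1+r_J}{(\delta(1-\hat\beta))^+}\big)$. If $\hat v<+\infty$, then $\hat c$ is a Nash equilibrium for the problem with complete information and risk aversion $\hat v$ for firm $J$, and for each $v<\hat v$, $\mathbb P(\mathcal V\le v)<\mathbb P(\mathcal V\le\hat v)$. If $\hat v=+\infty$, then for each $v\in(0,+\infty)$, $\mathbb P(\mathcal V\le v)<1$.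
   Context: Standing assumptions. $u>0$; $D>0$, $r_I,r_J\ge 0$, $\delta\in\mathbb R$, $x^+=\max(x,0)$. $\mu$ is a non-constant real random variable bounded from below by a finite constant $\underline\mu$, with $\mathbb E[e^{\lambda\mu}]<\infty$ for all $\lambda\in\mathbb R$. $\varphi,\psi:\mathbb R_+\to\mathbb R_+$ are $C^1$, increasing, strictly concave, $\varphi'(0)=\psi'(0)=+\infty$, $\varphi'(\infty)=\psi'(\infty)=0$, $\varphi(\infty)+\delta^+\psi(\infty)<\underline\mu$, and $(\varphi')^{-1}(x)\sim(\psi')^{-1}(x)$ as $x\to0$. $g:\mathbb R_+\to\mathbb R$ is $C^1$, increasing, strictly concave, $g'(0)=\infty$, $g'(\infty)=0$, and $\inf\{m>0:g(m)>0\}<\infty$. $b^a,b^m,b^e:\mathbb R_+\to\mathbb R_+$ are $C^1$, increasing, concave; $(b^a)'(0)>0$ (possibly infinite), $(b^a)'(\infty)=0$, $b^a(\infty)<\infty$; $(b^m)'(0)=(b^e)'(0)=\infty$, $(b^m)'(\infty)=(b^e)'(\infty)=0$. $f:\mathbb R_+\to\mathbb R$ is differentiable, increasing, strictly convex, $f'(\infty)=\infty$. $F(a)=b^a(a)-f((1+r_I)(D+a))$, and it is assumed that $F'(0)>0$ (possibly infinite). Conventions: $(\phi')^{-1}(+\infty)=0$ for $\phi=\varphi,\psi,g$; $x/0=+\infty$ for $x>0$; $1/g'(0)=0$; $(+\infty)\cdot0=0$. Model. Let $c=(a,\alpha,\beta,\gamma,e,m)$ with $a,\alpha,\gamma,e,m\ge0$,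 $\beta\in\mathbb R$, and $C^{op}=\mu-\varphi(e)-\delta\psi(a)$. In Situation 1 firm $I$ controls $(\alpha,\beta,\gamma)$, firm $J$ controls $(a,e,m)$, and $$I(c)=\mathbb E\big[b^a(a)-e^{-u(b^m(m)+b^e(e)-\alpha-\beta C^{op}-\gamma g(m))}\big],\quad J(v,c)=-\mathbb E\big[e^{-v(\alpha+(\beta-1)C^{op}-e+\gamma g(m)-m-(1+r_J)(D+a))}\big].$$ In Situation 2 firm $I$ controls $(a,\alpha,\beta,\gamma)$, firm $J$ controls $(e,m)$, and $$I(c)=\mathbb E\big[F(a)-e^{-u(b^m(m)+b^e(e)-\alpha-\beta C^{op}-\gamma g(m))}\big],\quad J(v,c)=-\mathbb E\big[e^{-v(\alpha+(\beta-1)C^{op}-e+\gamma g(m)-m)}\big].$$ Complete information with risk aversion $v>0$ for firm $J$: $\hat c$ is a Nash equilibrium if firm $J$'s controls maximize $J(v,\cdot)$ given firm $I$'s controls, and firm $I$'s controls maximize $I$ subject to $J(v,\cdot)\ge-1$ given firm $J$'s controls. Incomplete information: firm $I$ perceives firm $J$'s risk aversion as a $(0,+\infty)$-valued random variable $\mathcal V$ with known distribution, independent of $\mu$, and gets the penalty $p\in\mathbb R\cup\{+\infty\}$ if firm $J$ does not accept the contract, i.e. if $J(\mathcal V,c)<-1$ (where $J(\mathcal V,c)$ is the function $J(\cdot,c)$ evaluated at $\mathcal V$). $\hat c$ is a Nash equilibrium with incomplete information if firm $J$'s controls maximize $J(v,\cdot)$ given firm $I$'s controls (the maximizer does not depend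 on the risk aversion $v>0$ of firm $J$), and firm $I$'s controls maximize $$I(c)\,\mathbb P(J(\mathcal V,c)\ge-1)-p\,\mathbb P(J(\mathcal V,c)<-1)$$ given firm $J$'s controls; the value for firm $I$ is this quantity at $\hat c$. *)

theory Defs
  imports "HOL-Probability.Probability" "HOL-Library.Landau_Symbols"
begin

text \<open>
  A function on \<open>\<real>\<^sub>+\<close> is a total function of type \<open>real \<Rightarrow> real\<close> of which only the values on
  \<open>{0..}\<close> are used.  Its derivative takes values in the extended reals, because the one-sided
  derivative at \<open>0\<close> may be infinite.
\<close>

definition ederiv :: "(real \<Rightarrow> real) \<Rightarrow> real \<Rightarrow> ereal" where
  "ederiv h x = (if x = 0 then Lim (at_right 0) (\<lambda>t. ereal ((h t - h 0) / t))
                 else ereal (deriv h x))"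

text \<open>
  If the limit in \<^const>\<open>ederiv\<close> at \<open>0\<close> does not exist, then by the mean value theorem the
  derivative has no limit at \<open>0\<close> either, so the last conjunct below fails: an unspecified
  value of \<^const>\<open>Lim\<close> cannot satisfy this predicate.
\<close>

definition C1_Rplus :: "(real \<Rightarrow> real) \<Rightarrow> bool" where
  "C1_Rplus h \<longleftrightarrow> continuous_on {0..} h \<and> (\<forall>x>0. h differentiable (at x))
                 \<and> continuous_on {0..} (ederiv h)"

text \<open>
  \<open>(h')\<^sup>-\<^sup>1\<close>.  When \<open>h'(0) = \<infinity>\<close> and \<open>h'\<close> is injective, \<open>deriv_inv h \<infinity> = 0\<close>.
\<close>

definition deriv_inv :: "(real \<Rightarrow> real) \<Rightarrow> ereal \<Rightarrow> real" where
  "deriv_inv h = the_inv_into {0..} (ederiv h)"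

definition lim_infty :: "(real \<Rightarrow> real) \<Rightarrow> ereal" where
  "lim_infty h = Lim at_top (\<lambda>x. ereal (h x))"

definition strictly_convex_on :: "real set \<Rightarrow> (real \<Rightarrow> real) \<Rightarrow> bool" where
  "strictly_convex_on S h \<longleftrightarrow> convex S \<and>
     (\<forall>x\<in>S. \<forall>y\<in>S. \<forall>t. x \<noteq> y \<and> 0 < t \<and> t < 1 \<longrightarrow>
        h ((1 - t) * x + t * y) < (1 - t) * h x + t * h y)"

definition strictly_concave_on :: "real set \<Rightarrow> (real \<Rightarrow> real) \<Rightarrow> bool" where
  "strictly_concave_on S h \<longleftrightarrow> strictly_convex_on S (\<lambda>x. - h x)"

record 'w model =
  Prob :: "'w measure"
  mu :: "'w \<Rightarrow> real"
  mu_low :: real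
  uI :: real  \<comment> \<open>the risk aversion \<open>u\<close> of firm \<open>I\<close>\<close>
  DD :: real
  rI :: real
  rJ :: real
  delta :: real
  phi :: "real \<Rightarrow> real"
  psi :: "real \<Rightarrow> real"
  gg :: "real \<Rightarrow> real"
  ba :: "real \<Rightarrow> real"
  bm :: "real \<Rightarrow> real"
  be :: "real \<Rightarrow> real"
  ff :: "real \<Rightarrow> real"

definition FF :: "'w model \<Rightarrow> real \<Rightarrow> real" where
  "FF P a = ba P a - ff P ((1 + rI P) * (DD P + a))"

text \<open>
  Increasing is read in the weak sense throughout.  In the arithmetic of type \<^typ>\<open>ereal\<close>,
  \<open>0 * \<infinity> = 0\<close>, \<open>1 / \<infinity> = 0\<close>, and \<open>x / 0 = \<infinity>\<close> for \<open>x > 0\<close>.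
\<close>

locale outsourcing_model = prob_space "Prob P" for P :: "'w model" +
  assumes u_pos: "0 < uI P"
    and D_pos: "0 < DD P"
    and rI_nonneg: "0 \<le> rI P"
    and rJ_nonneg: "0 \<le> rJ P"
    and mu_measurable: "mu P \<in> borel_measurable (Prob P)"
    and mu_nonconst: "\<not> (\<exists>k. AE \<omega> in Prob P. mu P \<omega> = k)"
    and mu_bounded: "AE \<omega> in Prob P. mu_low P \<le> mu P \<omega>"
    and mu_exp: "\<And>l. integrable (Prob P) (\<lambda>\<omega>. exp (l * mu P \<omega>))"
    and phi_nonneg: "\<And>x. 0 \<le> x \<Longrightarrow> 0 \<le> phi P x"
    and phi_C1: "C1_Rplus (phi P)"
    and phi_mono: "mono_on {0..} (phi P)"
    and phi_concave: "strictly_concave_on {0..} (phi P)"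
    and phi_deriv_0: "ederiv (phi P) 0 = \<infinity>"
    and phi_deriv_infty: "(deriv (phi P) \<longlongrightarrow> 0) at_top"
    and psi_nonneg: "\<And>x. 0 \<le> x \<Longrightarrow> 0 \<le> psi P x"
    and psi_C1: "C1_Rplus (psi P)"
    and psi_mono: "mono_on {0..} (psi P)"
    and psi_concave: "strictly_concave_on {0..} (psi P)"
    and psi_deriv_0: "ederiv (psi P) 0 = \<infinity>"
    and psi_deriv_infty: "(deriv (psi P) \<longlongrightarrow> 0) at_top"
    and phi_psi_infty:
      "lim_infty (phi P) + ereal (max (delta P) 0) * lim_infty (psi P) < ereal (mu_low P)"
    and phi_psi_equiv:
      "(\<lambda>x. deriv_inv (phi P) (ereal x)) \<sim>[at_right 0] (\<lambda>x. deriv_inv (psi P) (ereal x))"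
    and g_C1: "C1_Rplus (gg P)"
    and g_mono: "mono_on {0..} (gg P)"
    and g_concave: "strictly_concave_on {0..} (gg P)"
    and g_deriv_0: "ederiv (gg P) 0 = \<infinity>"
    and g_deriv_infty: "(deriv (gg P) \<longlongrightarrow> 0) at_top"
    and g_pos: "(INF m\<in>{m. 0 < m \<and> 0 < gg P m}. ereal m) < \<infinity>"
    and ba_nonneg: "\<And>x. 0 \<le> x \<Longrightarrow> 0 \<le> ba P x"
    and ba_C1: "C1_Rplus (ba P)"
    and ba_mono: "mono_on {0..} (ba P)"
    and ba_concave: "concave_on {0..} (ba P)"
    and ba_deriv_0: "0 < ederiv (ba P) 0"
    and ba_deriv_infty: "(deriv (ba P) \<longlongrightarrow> 0) at_top"
    and ba_infty: "lim_infty (ba P) < \<infinity>"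
    and bm_nonneg: "\<And>x. 0 \<le> x \<Longrightarrow> 0 \<le> bm P x"
    and bm_C1: "C1_Rplus (bm P)"
    and bm_mono: "mono_on {0..} (bm P)"
    and bm_concave: "concave_on {0..} (bm P)"
    and bm_deriv_0: "ederiv (bm P) 0 = \<infinity>"
    and bm_deriv_infty: "(deriv (bm P) \<longlongrightarrow> 0) at_top"
    and be_nonneg: "\<And>x. 0 \<le> x \<Longrightarrow> 0 \<le> be P x"
    and be_C1: "C1_Rplus (be P)"
    and be_mono: "mono_on {0..} (be P)"
    and be_concave: "concave_on {0..} (be P)"
    and be_deriv_0: "ederiv (be P) 0 = \<infinity>"
    and be_deriv_infty: "(deriv (be P) \<longlongrightarrow> 0) at_top"
    and f_diff: "ff P differentiable_on {0..}"
    and f_mono: "mono_on {0..} (ff P)"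
    and f_convex: "strictly_convex_on {0..} (ff P)"
    and f_deriv_infty: "filterlim (deriv (ff P)) at_top at_top"
    and F_deriv_0: "0 < ederiv (FF P) 0"

record contract =
  c_a :: real
  c_alpha :: real
  c_beta :: real
  c_gamma :: real
  c_e :: real
  c_m :: real

definition admissible :: "contract \<Rightarrow> bool" where
  "admissible c \<longleftrightarrow> 0 \<le> c_a c \<and> 0 \<le> c_alpha c \<and> 0 \<le> c_gamma c \<and> 0 \<le> c_e c \<and> 0 \<le> c_m c"

datatype situation = Situation1 | Situation2

definition Cop :: "'w model \<Rightarrow> contract \<Rightarrow> 'w \<Rightarrow> real" where
  "Cop P c \<omega> = mu P \<omega> - phi P (c_e c) - delta P * psi P (c_a c)"

definition payI :: "situation \<Rightarrow> 'w model \<Rightarrow> contract \<Rightarrow> real" where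
  "payI s P c = (\<integral>\<omega>. (case s of Situation1 \<Rightarrow> ba P (c_a c) | Situation2 \<Rightarrow> FF P (c_a c))
      - exp (- uI P * (bm P (c_m c) + be P (c_e c) - c_alpha c - c_beta c * Cop P c \<omega>
                       - c_gamma c * gg P (c_m c))) \<partial>Prob P)"

definition payJ :: "situation \<Rightarrow> 'w model \<Rightarrow> real \<Rightarrow> contract \<Rightarrow> real" where
  "payJ s P v c = - (\<integral>\<omega>. exp (- v * (c_alpha c + (c_beta c - 1) * Cop P c \<omega> - c_e c
      + c_gamma c * gg P (c_m c) - c_m c
      - (case s of Situation1 \<Rightarrow> (1 + rJ P) * (DD P + c_a c) | Situation2 \<Rightarrow> 0))) \<partial>Prob P)"

text \<open>
  The admissible contracts that firm \<open>I\<close> (resp. firm \<open>J\<close>) can reach from \<open>c\<close> by changing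
  only its own controls.
\<close>

definition devI :: "situation \<Rightarrow> contract \<Rightarrow> contract set" where
  "devI s c = {c'. admissible c' \<and> c_e c' = c_e c \<and> c_m c' = c_m c
                 \<and> (s = Situation1 \<longrightarrow> c_a c' = c_a c)}"

definition devJ :: "situation \<Rightarrow> contract \<Rightarrow> contract set" where
  "devJ s c = {c'. admissible c' \<and> c_alpha c' = c_alpha c \<and> c_beta c' = c_beta c
                 \<and> c_gamma c' = c_gamma c \<and> (s = Situation2 \<longrightarrow> c_a c' = c_a c)}"

definition nash_complete :: "situation \<Rightarrow> 'w model \<Rightarrow> real \<Rightarrow> contract \<Rightarrow> bool" where
  "nash_complete s P v c \<longleftrightarrow>
     is_arg_max (payJ s P v) (\<lambda>c'. c' \<in> devJ s c) c \<and>
     is_arg_max (payI s P) (\<lambda>c'. c' \<in> devI s c \<and> payJ s P v c' \<ge> - 1) c"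

definition incomplete_payI ::
    "situation \<Rightarrow> 'w model \<Rightarrow> ('w \<Rightarrow> real) \<Rightarrow> ereal \<Rightarrow> contract \<Rightarrow> ereal" where
  "incomplete_payI s P V p c =
     ereal (payI s P c) * ereal (measure (Prob P) {\<omega> \<in> space (Prob P). payJ s P (V \<omega>) c \<ge> - 1})
     - p * ereal (measure (Prob P) {\<omega> \<in> space (Prob P). payJ s P (V \<omega>) c < - 1})"

text \<open>
  Here \<open>v\<close> is the actual risk aversion of firm \<open>J\<close>, whereas \<open>V\<close> is firm \<open>I\<close>'s perception of it.
\<close>

definition nash_incomplete ::
    "situation \<Rightarrow> 'w model \<Rightarrow> ('w \<Rightarrow> real) \<Rightarrow> ereal \<Rightarrow> real \<Rightarrow> contract \<Rightarrow> bool" where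
  "nash_incomplete s P V p v c \<longleftrightarrow>
     is_arg_max (payJ s P v) (\<lambda>c'. c' \<in> devJ s c) c \<and>
     is_arg_max (incomplete_payI s P V p) (\<lambda>c'. c' \<in> devI s c) c"

definition v_hat :: "situation \<Rightarrow> 'w model \<Rightarrow> contract \<Rightarrow> ereal" where
  "v_hat s P c = (SUP v\<in>{v. 0 < v \<and> - payJ s P v c \<le> 1}. ereal v)"

end

theory Submission
  imports Defs
begin

text \<open>
  Firm \<open>J\<close>'s exponent splits into a deterministic part, which alone contains \<open>J\<close>'s controls, and a
  multiple of \<open>\<mu>\<close>. Hence \<open>J\<close>'s best response does not depend on \<open>v\<close> and is given by first-order
  conditions. As \<open>-J(v, c)\<close> is convex in \<open>v\<close> with value \<open>1\<close> at \<open>0\<close>, the contract \<open>c\<close> is accepted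
  exactly by the risk aversions up to \<open>v_hat\<close>. Since the value exceeds \<open>-p\<close>, no deviation of firm
  \<open>I\<close> that is accepted with at least the same probability can raise \<open>I(c)\<close>. But below \<open>v_hat\<close>
  there is always slack to exploit: for \<open>v < v_hat\<close> some deviation is accepted by all risk aversions
  up to \<open>v\<close> and raises \<open>I(c)\<close>, so \<open>P(V \<le> v)\<close> must be smaller than the acceptance probability.
\<close>

section \<open>Concave functions with infinite slope at the origin\<close>

lemma strictly_concave_on_imp_concave_on:
  assumes "strictly_concave_on S h"
  shows "concave_on S h"
proof -
  have S: "convex S" and *: "\<And>x y t. \<lbrakk>x \<in> S; y \<in> S; x \<noteq> y; 0 < t; t < 1\<rbrakk> \<Longrightarrow>
      - h ((1 - t) * x + t * y) < (1 - t) * - h x + t * - h y"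
    using assms unfolding strictly_concave_on_def strictly_convex_on_def by blast+
  have "convex_on S (\<lambda>x. - h x)"
  proof (intro convex_onI S)
    fix t x y :: real
    assume "0 < t" "t < 1" "x \<in> S" "y \<in> S"
    then show "- h ((1 - t) *\<^sub>R x + t *\<^sub>R y) \<le> (1 - t) * - h x + t * - h y"
      using *[of x y t] by (cases "x = y") (auto simp: algebra_simps)
  qed
  then show ?thesis by (simp add: concave_on_def)
qed

lemma concave_below_tangent:
  assumes "strictly_concave_on {0..} h" "0 < x" "h differentiable (at x)" "0 \<le> y"
  shows "h y \<le> h x + deriv h x * (y - x)"
proof -
  have "(h has_real_derivative deriv h x) (at x)"
    using assms(3) by (simp add: DERIV_deriv_iff_real_differentiable)
  then have "((\<lambda>x. - h x) has_real_derivative - deriv h x) (at x within {0..})"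
    by (intro DERIV_minus) (rule has_field_derivative_at_within)
  moreover have "convex_on {0..} (\<lambda>x. - h x)"
    using strictly_concave_on_imp_concave_on[OF assms(1)] by (simp add: concave_on_def)
  ultimately have "- h y - - h x \<ge> - deriv h x * (y - x)"
    using assms(2,4) by (intro convex_on_imp_above_tangent[of "{0..}"]) auto
  then show ?thesis by simp
qed

text \<open>If the slopes at \<open>x < y\<close> agree, the tangent at \<open>x\<close> bounds the
  midpoint value and the tangent at \<open>y\<close> bounds \<open>h x\<close>. Together they put
  the midpoint below the chord, against strict concavity. The infinite slope at 0 differs from every
  real one.\<close>

lemma inj_on_ederiv:
  assumes "C1_Rplus h" "strictly_concave_on {0..} h" "ederiv h 0 = \<infinity>"
  shows "inj_on (ederiv h) {0..}"
proof -
  have diff: "h differentiable (at x)" if "0 < x" for x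
    using assms(1) that by (simp add: C1_Rplus_def)
  have conv: "- h ((1 - t) * x + t * y) < (1 - t) * - h x + t * - h y"
    if "0 \<le> x" "0 \<le> y" "x \<noteq> y" "0 < t" "t < 1" for x y t
    using assms(2) that unfolding strictly_concave_on_def strictly_convex_on_def by simp
  have neq: "ederiv h x \<noteq> ederiv h y" if "0 \<le> x" "x < y" for x y
  proof (cases "x = 0")
    case True
    then show ?thesis using assms(3) that by (simp add: ederiv_def)
  next
    case False
    then have x: "0 < x" using that by simp
    show ?thesis
    proof
      assume "ederiv h x = ederiv h y"
      then have d: "deriv h x = deriv h y" using x that by (simp add: ederiv_def)
      have "- h ((1 - 1/2) * x + 1/2 * y) < (1 - 1/2) * - h x + 1/2 * - h y"
        by (rule conv) (use x that in auto)
      moreover have "h ((x + y) / 2) \<le> h x + deriv h x * ((x + y) / 2 - x)"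
        using x that by (intro concave_below_tangent assms diff) auto
      moreover have "h x \<le> h y + deriv h y * (x - y)"
        using x that by (intro concave_below_tangent assms diff) auto
      ultimately show False unfolding d by (simp add: field_simps)
    qed
  qed
  show ?thesis
    by (rule linorder_inj_onI') (use neq in auto)
qed

lemma deriv_inv_ederiv:
  assumes "C1_Rplus h" "strictly_concave_on {0..} h" "ederiv h 0 = \<infinity>" "0 \<le> x"
  shows "deriv_inv h (ederiv h x) = x"
  unfolding deriv_inv_def using assms by (intro the_inv_into_f_f inj_on_ederiv) auto

text \<open>Slopes exceed \<open>r\<close> near 0, so the mean value theorem gives a first increment
  steeper than \<open>r\<close>. This rules out a corner maximum at 0.\<close>

lemma steep_at_0:
  assumes "C1_Rplus h" "ederiv h 0 = \<infinity>"
  obtains t where "0 < t" "h t > h 0 + r * t"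
proof -
  have "continuous (at 0 within {0..}) (ederiv h)"
    using assms(1) by (simp add: C1_Rplus_def continuous_on_eq_continuous_within)
  then have "(ederiv h \<longlongrightarrow> \<infinity>) (at 0 within {0..})"
    using assms(2) by (simp add: continuous_within)
  then have "\<forall>\<^sub>F x in at 0 within {0..}. ereal r < ederiv h x"
    by (rule order_tendstoD) simp
  then obtain d where d: "0 < d" "\<And>x. \<lbrakk>0 \<le> x; x \<noteq> 0; dist x 0 < d\<rbrakk> \<Longrightarrow> ereal r < ederiv h x"
    unfolding eventually_at by auto
  define t where "t = d / 2"
  have t: "0 < t" "t < d" using d by (auto simp: t_def)
  have "\<exists>l z. 0 < z \<and> z < t \<and> DERIV h z :> l \<and> h t - h 0 = (t - 0) * l"
  proof (rule MVT[OF t(1)])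
    show "continuous_on {0..t} h"
      using assms(1) by (auto simp: C1_Rplus_def intro: continuous_on_subset)
    show "h differentiable (at x)" if "0 < x" "x < t" for x
      using assms(1) that by (simp add: C1_Rplus_def)
  qed
  then obtain l z where z: "0 < z" "z < t" "DERIV h z :> l" "h t - h 0 = t * l" by auto
  have "r < l"
    using d(2)[of z] z t DERIV_imp_deriv[OF z(3)] by (simp add: ederiv_def)
  then show thesis
    using that[of t] t z(4) by (simp add: mult.commute algebra_simps)
qed

text \<open>For \<open>k <= 0\<close> effort only costs, so the maximizer is 0. For
  \<open>k > 0\<close> the infinite slope pushes the maximizer off 0, and the interior first-order
  condition applies.\<close>

lemma linear_cost_argmax:
  assumes "C1_Rplus h" "mono_on {0..} h" "ederiv h 0 = \<infinity>"
    and "0 < K" "0 \<le> x" and max: "\<And>y. 0 \<le> y \<Longrightarrow> k * h y - K * y \<le> k * h x - K * x"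
  shows "(k \<le> 0 \<and> x = 0) \<or> (0 < k \<and> 0 < x \<and> ederiv h x = ereal (K / k))"
proof (cases "k \<le> 0")
  case True
  have "h 0 \<le> h x" using assms(2,5) by (auto intro: mono_onD)
  then have "k * h x \<le> k * h 0" using True by (simp add: mult_left_mono_neg)
  then have "K * x \<le> 0" using max[of 0] by simp
  then show ?thesis using assms(4,5) True by (simp add: mult_le_0_iff)
next
  case False
  then have k: "0 < k" by simp
  \<comment> \<open>With slope \<open>K / k\<close> the benefit gained by moving from 0 to
    \<open>t\<close> exceeds the cost \<open>K * t\<close>.\<close>
  obtain t where t: "0 < t" "h t > h 0 + K / k * t" using steep_at_0[OF assms(1,3)] by blast
  have "k * h t > k * h 0 + K * t"
    using mult_strict_left_mono[OF t(2) k] k by (simp add: algebra_simps)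
  then have x: "0 < x" using max[of t] t assms(5) by (cases "x = 0") auto
  have "h differentiable (at x)" using assms(1) x by (simp add: C1_Rplus_def)
  then have "(h has_real_derivative deriv h x) (at x)"
    by (simp add: DERIV_deriv_iff_real_differentiable)
  then have "((\<lambda>y. k * h y - K * y) has_real_derivative (k * deriv h x - K)) (at x)"
    by (auto intro!: derivative_eq_intros)
  then have "k * deriv h x - K = 0"
    by (rule DERIV_local_max[OF _ x]) (use max in auto)
  then show ?thesis using k x by (simp add: ederiv_def field_simps)
qed

text \<open>The corner case fits the same formula: for \<open>k <= 0\<close> the argument is
  \<open>K / 0\<close>, which is infinite and is the slope at 0.\<close>

lemma linear_cost_argmax_deriv_inv:
  assumes "C1_Rplus h" "strictly_concave_on {0..} h" "mono_on {0..} h" "ederiv h 0 = \<infinity>"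
    and "0 < K" "0 \<le> x" "\<And>y. 0 \<le> y \<Longrightarrow> k * h y - K * y \<le> k * h x - K * x"
  shows "x = deriv_inv h (ereal K / ereal (max k 0))"
  using linear_cost_argmax[OF assms(1,3-7)]
proof
  assume "k \<le> 0 \<and> x = 0"
  then show ?thesis
    using deriv_inv_ederiv[OF assms(1,2,4,6)] assms(4,5) by (simp add: max_def)
next
  assume "0 < k \<and> 0 < x \<and> ederiv h x = ereal (K / k)"
  then show ?thesis
    using deriv_inv_ederiv[OF assms(1,2,4,6)] by (simp add: max_def)
qed

text \<open>A monotone function converges in \<open>ereal\<close> to its supremum, so
  \<open>Lim\<close> denotes a genuine limit here.\<close>

lemma le_lim_infty:
  assumes "mono_on {0..} h" "0 \<le> x"
  shows "ereal (h x) \<le> lim_infty h"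
proof -
  define L where "L = (SUP y\<in>{0..}. ereal (h y))"
  have up: "ereal (h y) \<le> L" if "0 \<le> y" for y using that by (auto simp: L_def intro: SUP_upper)
  have "((\<lambda>y. ereal (h y)) \<longlongrightarrow> L) at_top"
  proof (rule order_tendstoI)
    fix l assume "l < L"
    then obtain y where y: "0 \<le> y" "l < ereal (h y)" unfolding L_def less_SUP_iff by auto
    show "\<forall>\<^sub>F z in at_top. l < ereal (h z)"
      using eventually_ge_at_top[of y]
    proof eventually_elim
      case (elim z)
      then have "h y \<le> h z" using assms(1) y by (auto intro: mono_onD)
      then show ?case using y(2) by (auto intro: less_le_trans)
    qed
  next
    fix l assume "L < l"
    show "\<forall>\<^sub>F z in at_top. ereal (h z) < l"
      using eventually_ge_at_top[of 0] by eventually_elim (use up \<open>L < l\<close> in \<open>auto intro: le_less_trans\<close>)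
  qed
  then have "lim_infty h = L" by (auto simp: lim_infty_def intro: tendsto_Lim)
  then show ?thesis using up assms(2) by simp
qed

section \<open>Exponential moments\<close>

text \<open>Squaring the weak bound at \<open>y / 2\<close> leaves the surplus
  \<open>y^2 / 4\<close>. If \<open>1 + y / 2\<close> is negative, so is
  \<open>1 + y\<close>.\<close>

lemma exp_gt_add_one:
  fixes y :: real
  assumes "y \<noteq> 0"
  shows "1 + y < exp y"
proof (cases "0 \<le> 1 + y / 2")
  case True
  have "(1 + y / 2) ^ 2 \<le> exp (y / 2) ^ 2"
    using True exp_ge_add_one_self by (intro power_mono) auto
  also have "\<dots> = exp y" by (simp add: power2_eq_square flip: exp_add)
  finally have "1 + y + y\<^sup>2 / 4 \<le> exp y" by (simp add: power2_eq_square algebra_simps)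
  moreover have "0 < y\<^sup>2" using assms by simp
  ultimately show ?thesis by linarith
next
  case False
  then show ?thesis using exp_gt_zero[of y] by linarith
qed

text \<open>Strict convexity of \<open>exp\<close> on the segment from 0 to
  \<open>v * x\<close>.\<close>

lemma exp_less_chord:
  fixes x v w :: real
  assumes "0 < w" "w < v" "x \<noteq> 0"
  shows "exp (w * x) < (1 - w / v) + w / v * exp (v * x)"
proof -
  let ?E = "exp (w * x)" and ?p = "w / v"
  have p: "0 < ?p" "?p < 1" using assms by auto
  have "?E * (1 + - (w * x)) < ?E * exp (- (w * x))"
    using assms by (intro mult_strict_left_mono exp_gt_add_one) auto
  then have 1: "?E * (1 - w * x) < 1" by (simp flip: exp_add)
  have "?E * (1 + (v * x - w * x)) \<le> ?E * exp (v * x - w * x)"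
    by (intro mult_left_mono exp_ge_add_one_self) auto
  then have 2: "?E * (1 + (v * x - w * x)) \<le> exp (v * x)" by (simp flip: exp_add)
  \<comment> \<open>The tangent at \<open>w * x\<close>, evaluated at 0 and \<open>v * x\<close>,
    averages back to the value at \<open>w * x\<close>.\<close>
  have "?E = (1 - ?p) * (?E * (1 - w * x)) + ?p * (?E * (1 + (v * x - w * x)))"
    using assms by (simp add: field_simps)
  also have "\<dots> < (1 - ?p) * 1 + ?p * exp (v * x)"
    using 1 2 p by (intro add_less_le_mono mult_strict_left_mono mult_left_mono) auto
  finally show ?thesis by simp
qed

section \<open>Convexity of moment generating functions and gains from sharing risk\<close>

context prob_space
begin

text \<open>This property survives affine maps, so all random quantities of the game inherit it from
  \<open>mu P\<close>. Both signs of \<open>t\<close> are covered because coefficients such as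
  \<open>c_beta\<close> have no fixed sign.\<close>

definition exp_moments :: "('a \<Rightarrow> real) \<Rightarrow> bool" where
  "exp_moments X \<longleftrightarrow> X \<in> borel_measurable M \<and> (\<forall>t. integrable M (\<lambda>\<omega>. exp (t * X \<omega>)))"

lemma exp_momentsD:
  assumes "exp_moments X"
  shows "X \<in> borel_measurable M" "integrable M (\<lambda>\<omega>. exp (t * X \<omega>))"
  using assms by (auto simp: exp_moments_def)

lemma exp_moments_affine:
  assumes "exp_moments X"
  shows "exp_moments (\<lambda>\<omega>. k + b * X \<omega>)"
  unfolding exp_moments_def
proof (intro conjI allI)
  show "(\<lambda>\<omega>. k + b * X \<omega>) \<in> borel_measurable M"
    using exp_momentsD(1)[OF assms] by measurable
  fix t
  have "integrable M (\<lambda>\<omega>. exp (t * k) * exp (t * b * X \<omega>))"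
    using assms unfolding exp_moments_def by (intro integrable_mult_right) blast
  then show "integrable M (\<lambda>\<omega>. exp (t * (k + b * X \<omega>)))"
    by (simp add: algebra_simps flip: exp_add)
qed

text \<open>A finite convex function on the whole line is continuous.\<close>

lemma mgf_continuous:
  assumes "exp_moments X"
  shows "continuous_on UNIV (\<lambda>t. expectation (\<lambda>\<omega>. exp (t * X \<omega>)))"
proof (rule convex_on_continuous[OF open_UNIV])
  show "convex_on UNIV (\<lambda>t. expectation (\<lambda>\<omega>. exp (t * X \<omega>)))"
  proof (intro convex_onI convex_UNIV)
    fix r x y :: real
    assume r: "0 < r" "r < 1"
    have "expectation (\<lambda>\<omega>. exp (((1 - r) *\<^sub>R x + r *\<^sub>R y) * X \<omega>))
        \<le> expectation (\<lambda>\<omega>. (1 - r) * exp (x * X \<omega>) + r * exp (y * X \<omega>))"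
    proof (intro integral_mono)
      fix \<omega>
      have "convex_on UNIV (exp :: real \<Rightarrow> real)" by (rule exp_convex)
      from convex_onD[OF this, of r "x * X \<omega>" "y * X \<omega>"] r
      show "exp (((1 - r) *\<^sub>R x + r *\<^sub>R y) * X \<omega>) \<le> (1 - r) * exp (x * X \<omega>) + r * exp (y * X \<omega>)"
        by (simp add: algebra_simps)
    qed (use exp_momentsD[OF assms] in auto)
    also have "\<dots> = (1 - r) * expectation (\<lambda>\<omega>. exp (x * X \<omega>)) + r * expectation (\<lambda>\<omega>. exp (y * X \<omega>))"
      using exp_momentsD[OF assms] by simp
    finally show "expectation (\<lambda>\<omega>. exp (((1 - r) *\<^sub>R x + r *\<^sub>R y) * X \<omega>))
        \<le> (1 - r) * expectation (\<lambda>\<omega>. exp (x * X \<omega>)) + r * expectation (\<lambda>\<omega>. exp (y * X \<omega>))" .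
  qed
qed

text \<open>The moment generating function is convex with value 1 at 0, so it is at most 1 between 0
  and \<open>v\<close>. Reaching 1 at \<open>w\<close> makes the chord inequality tight almost
  everywhere, which happens only where \<open>X\<close> vanishes.\<close>

lemma mgf_less_1:
  assumes X: "exp_moments X" and wv: "0 < w" "w < v"
    and v: "expectation (\<lambda>\<omega>. exp (v * X \<omega>)) \<le> 1"
    and w: "expectation (\<lambda>\<omega>. exp (w * X \<omega>)) \<ge> 1"
  shows "AE \<omega> in M. X \<omega> = 0"
proof -
  note [simp] = exp_momentsD[OF X]
  let ?D = "\<lambda>\<omega>. (1 - w / v) + w / v * exp (v * X \<omega>) - exp (w * X \<omega>)"
  have nn: "0 \<le> ?D \<omega>" for \<omega>
    using exp_less_chord[OF wv, of "X \<omega>"] by (cases "X \<omega> = 0") auto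
  have int: "integrable M ?D" by simp
  have "expectation ?D = (1 - w / v) + w / v * expectation (\<lambda>\<omega>. exp (v * X \<omega>))
      - expectation (\<lambda>\<omega>. exp (w * X \<omega>))"
    by (simp add: prob_space)
  also have "\<dots> \<le> 0"
    using mult_left_mono[OF v, of "w / v"] wv w by simp
  finally have "expectation ?D \<le> 0" .
  moreover have "0 \<le> expectation ?D"
    by (rule integral_nonneg_AE) (use nn in auto)
  ultimately have "expectation ?D = 0" by (rule antisym)
  then have "AE \<omega> in M. ?D \<omega> = 0"
    using integral_nonneg_eq_0_iff_AE[OF int] nn by auto
  then show ?thesis
  proof eventually_elim
    case (elim \<omega>)
    then show ?case using exp_less_chord[OF wv, of "X \<omega>"] by (cases "X \<omega> = 0") auto
  qed
qed

lemma mgf_le_1: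
  assumes X: "exp_moments X" and wv: "0 < w" "w \<le> v"
    and v: "expectation (\<lambda>\<omega>. exp (v * X \<omega>)) \<le> 1"
  shows "expectation (\<lambda>\<omega>. exp (w * X \<omega>)) \<le> 1"
proof (rule ccontr)
  assume gt: "\<not> ?thesis"
  then have "w < v" using wv v by (cases "w = v") auto
  with gt have "AE \<omega> in M. X \<omega> = 0" using mgf_less_1[OF X wv(1) _ v] by simp
  then have "expectation (\<lambda>\<omega>. exp (w * X \<omega>)) = expectation (\<lambda>\<omega>. 1)"
    using exp_momentsD(1)[OF X] by (intro integral_cong_AE) auto
  then show False using gt by (simp add: prob_space)
qed

text \<open>Since \<open>C <= exp C\<close>, the factor \<open>C\<close> costs one unit of exponent.
  The bound is uniform in \<open>s <= t\<close>, as dominated convergence requires.\<close>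

lemma dominated_moment:
  assumes "exp_moments C" "AE \<omega> in M. 0 < C \<omega>" "s \<le> t"
  shows "AE \<omega> in M. norm (C \<omega> * exp (s * C \<omega>)) \<le> exp ((t + 1) * C \<omega>)"
  using assms(2)
proof eventually_elim
  case (elim \<omega>)
  have "C \<omega> \<le> exp (C \<omega>)" using exp_ge_add_one_self[of "C \<omega>"] by linarith
  then have "C \<omega> * exp (s * C \<omega>) \<le> exp (C \<omega>) * exp (t * C \<omega>)"
    using elim assms(3) by (intro mult_mono) (auto simp: mult_right_mono)
  then show ?case using elim by (simp add: algebra_simps flip: exp_add)
qed

lemma integrable_moment:
  assumes "exp_moments C" "AE \<omega> in M. 0 < C \<omega>"
  shows "integrable M (\<lambda>\<omega>. C \<omega> * exp (s * C \<omega>))"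
proof (rule Bochner_Integration.integrable_bound)
  show "integrable M (\<lambda>\<omega>. exp ((s + 1) * C \<omega>))" using exp_momentsD[OF assms(1)] by blast
  show "(\<lambda>\<omega>. C \<omega> * exp (s * C \<omega>)) \<in> borel_measurable M"
    using exp_momentsD(1)[OF assms(1)] by measurable
  show "AE \<omega> in M. norm (C \<omega> * exp (s * C \<omega>)) \<le> norm (exp ((s + 1) * C \<omega>))"
    using dominated_moment[OF assms order_refl, of s] by simp
qed

lemma moment_tendsto:
  assumes C: "exp_moments C" "AE \<omega> in M. 0 < C \<omega>" and t: "\<And>n. t n \<le> T" "t \<longlonglongrightarrow> l"
  shows "(\<lambda>n. expectation (\<lambda>\<omega>. C \<omega> * exp (t n * C \<omega>))) \<longlonglongrightarrow> expectation (\<lambda>\<omega>. C \<omega> * exp (l * C \<omega>))"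
proof (rule integral_dominated_convergence)
  note [measurable] = exp_momentsD(1)[OF C(1)]
  show "(\<lambda>\<omega>. C \<omega> * exp (l * C \<omega>)) \<in> borel_measurable M" by measurable
  show "\<And>n. (\<lambda>\<omega>. C \<omega> * exp (t n * C \<omega>)) \<in> borel_measurable M" by measurable
  show "integrable M (\<lambda>\<omega>. exp ((T + 1) * C \<omega>))" using exp_momentsD[OF C(1)] by blast
  show "AE \<omega> in M. (\<lambda>n. C \<omega> * exp (t n * C \<omega>)) \<longlonglongrightarrow> C \<omega> * exp (l * C \<omega>)"
    using t(2) by (intro AE_I2 tendsto_intros)
  show "\<And>n. AE \<omega> in M. norm (C \<omega> * exp (t n * C \<omega>)) \<le> exp ((T + 1) * C \<omega>)"
    using dominated_moment[OF C t(1)] .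
qed

text \<open>\<open>C\<close> and \<open>exp (u * C)\<close> increase together: the product of their
  deviations from the values at the mean is nonnegative and vanishes only where \<open>C\<close>
  equals its mean. Its expectation is the covariance.\<close>

lemma exp_covariance_pos:
  assumes C: "exp_moments C" "AE \<omega> in M. 0 < C \<omega>" and nc: "\<not> (\<exists>k. AE \<omega> in M. C \<omega> = k)" and u: "0 < u"
  shows "expectation C * expectation (\<lambda>\<omega>. exp (u * C \<omega>)) < expectation (\<lambda>\<omega>. C \<omega> * exp (u * C \<omega>))"
proof -
  let ?m = "expectation C"
  let ?h = "\<lambda>\<omega>. (C \<omega> - ?m) * (exp (u * C \<omega>) - exp (u * ?m))"
  note [simp] = exp_momentsD[OF C(1)] integrable_moment[OF C]
  have [simp]: "integrable M C" using integrable_moment[OF C, of 0] by simp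
  have h: "?h = (\<lambda>\<omega>. C \<omega> * exp (u * C \<omega>) - ?m * exp (u * C \<omega>) - exp (u * ?m) * C \<omega> + ?m * exp (u * ?m))"
    by (auto simp: algebra_simps)
  have int: "integrable M ?h" unfolding h by simp
  have eq: "expectation ?h = expectation (\<lambda>\<omega>. C \<omega> * exp (u * C \<omega>)) - ?m * expectation (\<lambda>\<omega>. exp (u * C \<omega>))"
    unfolding h by (simp add: prob_space)
  have nn: "0 \<le> ?h \<omega>" for \<omega>
  proof (cases "C \<omega> \<le> ?m")
    case True
    then show ?thesis using u by (intro mult_nonpos_nonpos) auto
  next
    case False
    then show ?thesis using u by (intro mult_nonneg_nonneg) auto
  qed
  have "expectation ?h \<noteq> 0"
  proof
    assume "expectation ?h = 0"
    then have "AE \<omega> in M. ?h \<omega> = 0"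
      using integral_nonneg_eq_0_iff_AE[OF int] nn by auto
    then have "AE \<omega> in M. C \<omega> = ?m" by eventually_elim (use u in auto)
    then show False using nc by blast
  qed
  moreover have "0 \<le> expectation ?h" using nn by (intro integral_nonneg_AE) auto
  ultimately show ?thesis using eq by simp
qed

text \<open>
  Replacing the random cost \<open>C\<close> by \<open>(1 - \<epsilon>) C + \<epsilon> d\<close> lowers the exponential cost for the party of
  risk aversion \<open>u\<close>.  The price \<open>d = E[C exp(v \<epsilon> C)]\<close> suffices for the other party because
  \<open>exp y \<le> 1 + y exp y\<close>, and since \<open>d \<rightarrow> E C\<close> as \<open>\<epsilon> \<rightarrow> 0\<close>, the first-order gain is the
  covariance of \<open>C\<close> and \<open>exp(u C)\<close>.
\<close>

lemma risk_sharing: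
  assumes C: "exp_moments C" "AE \<omega> in M. 0 < C \<omega>" and nc: "\<not> (\<exists>k. AE \<omega> in M. C \<omega> = k)"
    and u: "0 < u" and v: "0 < v"
  obtains \<epsilon> d where "0 < \<epsilon>" "0 \<le> d"
    "expectation (\<lambda>\<omega>. exp (v * (\<epsilon> * (C \<omega> - d)))) \<le> 1"
    "expectation (\<lambda>\<omega>. exp (u * (C \<omega> + \<epsilon> * (d - C \<omega>)))) < expectation (\<lambda>\<omega>. exp (u * C \<omega>))"
proof -
  note [simp] = exp_momentsD[OF C(1)] integrable_moment[OF C]
  have [simp]: "integrable M C" using integrable_moment[OF C, of 0] by simp
  define e where "e n = inverse (real (Suc n))" for n
  have e0: "e \<longlonglongrightarrow> 0" unfolding e_def by (rule LIMSEQ_inverse_real_of_nat)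
  have e: "0 < e n" "e n \<le> 1" for n by (auto simp: e_def field_simps)
  define d where "d n = expectation (\<lambda>\<omega>. C \<omega> * exp (v * e n * C \<omega>))" for n
  have d: "d \<longlonglongrightarrow> expectation (\<lambda>\<omega>. C \<omega> * exp (v * 0 * C \<omega>))"
    unfolding d_def
  proof (rule moment_tendsto[OF C, of _ v])
    show "v * e n \<le> v" for n using e[of n] v by simp
    show "(\<lambda>n. v * e n) \<longlonglongrightarrow> v * 0" by (intro tendsto_intros e0)
  qed
  have N: "(\<lambda>n. expectation (\<lambda>\<omega>. C \<omega> * exp (u * (1 - e n) * C \<omega>)))
      \<longlonglongrightarrow> expectation (\<lambda>\<omega>. C \<omega> * exp (u * (1 - 0) * C \<omega>))"
  proof (rule moment_tendsto[OF C, of _ u])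
    show "u * (1 - e n) \<le> u" for n using e[of n] u by (simp add: algebra_simps)
    show "(\<lambda>n. u * (1 - e n)) \<longlonglongrightarrow> u * (1 - 0)" by (intro tendsto_intros e0)
  qed
  have R: "(\<lambda>n. expectation (\<lambda>\<omega>. exp (u * (1 - e n) * C \<omega>)))
      \<longlonglongrightarrow> expectation (\<lambda>\<omega>. exp (u * (1 - 0) * C \<omega>))"
  proof (rule continuous_on_tendsto_compose[OF mgf_continuous[OF C(1)]])
    show "(\<lambda>n. u * (1 - e n)) \<longlonglongrightarrow> u * (1 - 0)" by (intro tendsto_intros e0)
  qed simp_all
  have "(\<lambda>n. expectation (\<lambda>\<omega>. C \<omega> * exp (u * (1 - e n) * C \<omega>)) - d n * expectation (\<lambda>\<omega>. exp (u * (1 - e n) * C \<omega>)))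
      \<longlonglongrightarrow> expectation (\<lambda>\<omega>. C \<omega> * exp (u * C \<omega>)) - expectation C * expectation (\<lambda>\<omega>. exp (u * C \<omega>))"
    using tendsto_diff[OF N tendsto_mult[OF d R]] by simp
  moreover have "0 < expectation (\<lambda>\<omega>. C \<omega> * exp (u * C \<omega>)) - expectation C * expectation (\<lambda>\<omega>. exp (u * C \<omega>))"
    using exp_covariance_pos[OF C nc u] by simp
  ultimately have "\<forall>\<^sub>F n in sequentially.
      0 < expectation (\<lambda>\<omega>. C \<omega> * exp (u * (1 - e n) * C \<omega>)) - d n * expectation (\<lambda>\<omega>. exp (u * (1 - e n) * C \<omega>))"
    by (rule order_tendstoD(1))
  \<comment> \<open>The first-order gain is needed at the already reduced exponent
    \<open>u * (1 - e n)\<close>, not just in the limit.\<close>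
  then obtain n where n:
    "0 < expectation (\<lambda>\<omega>. C \<omega> * exp (u * (1 - e n) * C \<omega>)) - d n * expectation (\<lambda>\<omega>. exp (u * (1 - e n) * C \<omega>))"
    using eventually_happens by force
  let ?e = "e n" and ?d = "d n"
  show thesis
  proof (rule that[of ?e ?d])
    show "0 < ?e" by (rule e)
    show "0 \<le> ?d" unfolding d_def
      by (rule integral_nonneg_AE) (use C(2) in \<open>auto elim!: eventually_mono\<close>)
    have "expectation (\<lambda>\<omega>. exp (v * ?e * C \<omega>)) \<le> expectation (\<lambda>\<omega>. 1 + v * ?e * (C \<omega> * exp (v * ?e * C \<omega>)))"
    proof (rule integral_mono)
      fix \<omega>
      let ?y = "v * ?e * C \<omega>"
      have "exp ?y * (1 + - ?y) \<le> exp ?y * exp (- ?y)"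
        by (intro mult_left_mono exp_ge_add_one_self) auto
      then show "exp ?y \<le> 1 + v * ?e * (C \<omega> * exp ?y)"
        by (simp add: algebra_simps flip: exp_add)
    qed simp_all
    also have "\<dots> = 1 + v * ?e * ?d" by (simp add: prob_space d_def)
    also have "\<dots> \<le> exp (v * ?e * ?d)" by (rule exp_ge_add_one_self)
    finally have "exp (- (v * ?e * ?d)) * expectation (\<lambda>\<omega>. exp (v * ?e * C \<omega>))
        \<le> exp (- (v * ?e * ?d)) * exp (v * ?e * ?d)"
      by (intro mult_left_mono) auto
    then have "exp (- (v * ?e * ?d)) * expectation (\<lambda>\<omega>. exp (v * ?e * C \<omega>)) \<le> 1"
      by (simp flip: exp_add)
    then have le: "expectation (\<lambda>\<omega>. exp (- (v * ?e * ?d)) * exp (v * ?e * C \<omega>)) \<le> 1"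
      by (subst integral_mult_right_zero)
    have "(\<lambda>\<omega>. exp (- (v * ?e * ?d)) * exp (v * ?e * C \<omega>)) = (\<lambda>\<omega>. exp (v * (?e * (C \<omega> - ?d))))"
      by (auto simp: algebra_simps simp flip: exp_add)
    with le show "expectation (\<lambda>\<omega>. exp (v * (?e * (C \<omega> - ?d)))) \<le> 1" by simp
    \<comment> \<open>\<open>?f\<close> is the exponential of the shared cost, and
      \<open>?f + ?g\<close> is its tangent bound for \<open>exp (u * C)\<close>. The choice of
      \<open>n\<close> makes the expectation of \<open>?g\<close> positive.\<close>
    let ?f = "\<lambda>\<omega>. exp (u * ?e * ?d) * exp (u * (1 - ?e) * C \<omega>)"
    let ?g = "\<lambda>\<omega>. u * ?e * exp (u * ?e * ?d) *
      (C \<omega> * exp (u * (1 - ?e) * C \<omega>) - ?d * exp (u * (1 - ?e) * C \<omega>))"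
    have f: "(\<lambda>\<omega>. exp (u * (C \<omega> + ?e * (?d - C \<omega>)))) = ?f"
      by (auto simp: algebra_simps simp flip: exp_add)
    have "0 < u * ?e * exp (u * ?e * ?d) * (expectation (\<lambda>\<omega>. C \<omega> * exp (u * (1 - e n) * C \<omega>))
        - d n * expectation (\<lambda>\<omega>. exp (u * (1 - e n) * C \<omega>)))"
      using n u e(1)[of n] by simp
    also have "\<dots> = expectation ?g" by simp
    finally have "expectation ?f < expectation ?f + expectation ?g" by simp
    also have "\<dots> = expectation (\<lambda>\<omega>. ?f \<omega> + ?g \<omega>)" by simp
    also have "\<dots> \<le> expectation (\<lambda>\<omega>. exp (u * C \<omega>))"
    proof (rule integral_mono)
      fix \<omega>
      let ?y = "u * ?e * (C \<omega> - ?d)"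
      have "?f \<omega> * (1 + ?y) \<le> ?f \<omega> * exp ?y"
        by (intro mult_left_mono exp_ge_add_one_self) auto
      also have "?f \<omega> * exp ?y = exp (u * C \<omega>)" by (simp add: algebra_simps flip: exp_add)
      finally show "?f \<omega> + ?g \<omega> \<le> exp (u * C \<omega>)" by (simp add: algebra_simps)
    qed simp_all
    finally show "expectation (\<lambda>\<omega>. exp (u * (C \<omega> + ?e * (?d - C \<omega>)))) < expectation (\<lambda>\<omega>. exp (u * C \<omega>))"
      unfolding f .
  qed
qed

end

section \<open>The contract game\<close>

text \<open>Each of \<open>c_e\<close>, \<open>c_m\<close> and \<open>c_a\<close> sits in its own
  bracket, so the minimization over firm J's controls splits into problems of the form in
  \<open>linear_cost_argmax\<close>.\<close>

definition fixedJ :: "situation \<Rightarrow> 'w model \<Rightarrow> contract \<Rightarrow> real" where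
  "fixedJ s P c = (c_e c - (1 - c_beta c) * phi P (c_e c)) + (c_m c - c_gamma c * gg P (c_m c))
     + ((case s of Situation1 \<Rightarrow> (1 + rJ P) * (DD P + c_a c) | Situation2 \<Rightarrow> 0)
        - (1 - c_beta c) * delta P * psi P (c_a c)) - c_alpha c"

text \<open>The negative of firm J's profit: acceptance says that the exponential moment of the loss
  at \<open>v\<close> is at most 1.\<close>

definition lossJ :: "situation \<Rightarrow> 'w model \<Rightarrow> contract \<Rightarrow> 'w \<Rightarrow> real" where
  "lossJ s P c \<omega> = fixedJ s P c + (1 - c_beta c) * mu P \<omega>"

definition costI :: "'w model \<Rightarrow> contract \<Rightarrow> 'w \<Rightarrow> real" where
  "costI P c \<omega> = (c_alpha c + c_gamma c * gg P (c_m c) - bm P (c_m c) - be P (c_e c))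
     + c_beta c * Cop P c \<omega>"

lemma payJ_lossJ: "payJ s P v c = - (\<integral>\<omega>. exp (v * lossJ s P c \<omega>) \<partial>Prob P)"
proof -
  have "- v * (c_alpha c + (c_beta c - 1) * Cop P c \<omega> - c_e c + c_gamma c * gg P (c_m c) - c_m c
      - (case s of Situation1 \<Rightarrow> (1 + rJ P) * (DD P + c_a c) | Situation2 \<Rightarrow> 0)) = v * lossJ s P c \<omega>"
    for \<omega> by (simp add: lossJ_def fixedJ_def Cop_def algebra_simps split: situation.split)
  then show ?thesis unfolding payJ_def by presburger
qed

text \<open>Firm I's criterion with payoff \<open>I\<close> and acceptance probability
  \<open>A\<close> as plain numbers. For an infinite penalty, \<open>p * 0 = 0\<close> keeps the
  value finite when \<open>A = 1\<close>.\<close>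

definition incomplete_value :: "ereal \<Rightarrow> real \<Rightarrow> real \<Rightarrow> ereal" where
  "incomplete_value p I A = ereal I * ereal A - p * ereal (1 - A)"

lemma incomplete_value_gt_penalty:
  assumes "p \<noteq> -\<infinity>" "incomplete_value p I A > - p"
  shows "A \<noteq> 0"
  using assms by (cases p) (auto simp: incomplete_value_def simp flip: one_ereal_def zero_ereal_def)

text \<open>For real \<open>p\<close> the value is \<open>(I + p) * A - p\<close>, and exceeding
  \<open>- p\<close> forces \<open>I + p > 0\<close>, so raising \<open>I\<close> without lowering
  \<open>A\<close> helps. For infinite \<open>p\<close> it forces \<open>A = 1\<close>.\<close>

lemma incomplete_value_improves:
  assumes p: "p \<noteq> -\<infinity>" "incomplete_value p I A > - p" and A: "0 \<le> A" "A \<le> A'" "A' \<le> 1"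
    and I: "I < I'"
  shows "incomplete_value p I A < incomplete_value p I' A'"
proof (cases p)
  case (real r)
  have "A \<noteq> 0" by (rule incomplete_value_gt_penalty[OF p])
  then have A0: "0 < A" using A by simp
  have "0 < (I + r) * A" using p(2) real by (simp add: incomplete_value_def algebra_simps)
  then have "0 < I + r" using A0 by (simp add: zero_less_mult_iff)
  have "(I + r) * A < (I' + r) * A" using A0 I by simp
  also have "\<dots> \<le> (I' + r) * A'" using A I \<open>0 < I + r\<close> by (intro mult_left_mono) auto
  finally show ?thesis using real by (simp add: incomplete_value_def algebra_simps)
next
  case PInf
  have "A = 1"
  proof (rule ccontr)
    assume "A \<noteq> 1"
    then have "0 < 1 - A" using A by simp
    then show False using p(2) PInf by (simp add: incomplete_value_def)
  qed
  then show ?thesis using A I PInf by (simp add: incomplete_value_def)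
next
  case MInf
  then show ?thesis using p by simp
qed

section \<open>Best responses and improving deviations in the game\<close>

context outsourcing_model
begin

lemma exp_moments_mu: "exp_moments (mu P)"
  using mu_measurable mu_exp by (simp add: exp_moments_def)

lemma exp_moments_Cop: "exp_moments (Cop P c)"
proof -
  have "Cop P c = (\<lambda>\<omega>. - (phi P (c_e c) + delta P * psi P (c_a c)) + 1 * mu P \<omega>)"
    by (auto simp: Cop_def)
  then show ?thesis by (metis exp_moments_affine[OF exp_moments_mu])
qed

lemma exp_moments_lossJ: "exp_moments (lossJ s P c)"
  unfolding lossJ_def[abs_def] by (rule exp_moments_affine[OF exp_moments_mu])

lemma exp_moments_costI: "exp_moments (costI P c)"
  unfolding costI_def[abs_def] by (rule exp_moments_affine[OF exp_moments_Cop])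

lemma payJ_continuous: "continuous_on UNIV (\<lambda>v. payJ s P v c)"
  unfolding payJ_lossJ by (intro continuous_intros mgf_continuous exp_moments_lossJ)

lemma payJ_ge_antimono:
  assumes "0 < v" "v \<le> w" "- 1 \<le> payJ s P w c"
  shows "- 1 \<le> payJ s P v c"
  using mgf_le_1[OF exp_moments_lossJ assms(1,2), of s c] assms(3) by (simp add: payJ_lossJ)

text \<open>Improving deviations are sought with \<open>c_a\<close> fixed even in Situation 2, so
  the deterministic benefit cancels and only the exponential moment of firm I's cost
  matters.\<close>

lemma payI_less:
  assumes "c_a c' = c_a c"
    and "expectation (\<lambda>\<omega>. exp (uI P * costI P c' \<omega>)) < expectation (\<lambda>\<omega>. exp (uI P * costI P c \<omega>))"
  shows "payI s P c < payI s P c'"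
proof -
  have "payI s P d = (case s of Situation1 \<Rightarrow> ba P (c_a d) | Situation2 \<Rightarrow> FF P (c_a d))
      - expectation (\<lambda>\<omega>. exp (uI P * costI P d \<omega>))" for d
  proof -
    have "- uI P * (bm P (c_m d) + be P (c_e d) - c_alpha d - c_beta d * Cop P d \<omega>
        - c_gamma d * gg P (c_m d)) = uI P * costI P d \<omega>" for \<omega>
      by (simp add: costI_def algebra_simps)
    then have "payI s P d = (\<integral>\<omega>. (case s of Situation1 \<Rightarrow> ba P (c_a d) | Situation2 \<Rightarrow> FF P (c_a d))
      - exp (uI P * costI P d \<omega>) \<partial>Prob P)"
      unfolding payI_def by presburger
    then show ?thesis
      using exp_momentsD(2)[OF exp_moments_costI] by (simp add: prob_space)
  qed
  then show ?thesis using assms by (simp split: situation.split)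
qed

text \<open>By monotonicity the bound on the limits at infinity controls all finite values. A
  negative \<open>delta P\<close> only raises the cost, as \<open>psi P\<close> is
  nonnegative.\<close>

lemma Cop_pos:
  assumes "admissible c"
  shows "AE \<omega> in Prob P. 0 < Cop P c \<omega>"
proof -
  have c: "0 \<le> c_e c" "0 \<le> c_a c" using assms by (auto simp: admissible_def)
  have "ereal (phi P (c_e c) + max (delta P) 0 * psi P (c_a c))
      = ereal (phi P (c_e c)) + ereal (max (delta P) 0) * ereal (psi P (c_a c))"
    by (simp del: ereal_max)
  also have "\<dots> \<le> lim_infty (phi P) + ereal (max (delta P) 0) * lim_infty (psi P)"
    by (intro add_mono ereal_mult_left_mono le_lim_infty phi_mono psi_mono c) (auto simp del: ereal_max)
  also have "\<dots> < ereal (mu_low P)" by (rule phi_psi_infty)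
  finally have *: "phi P (c_e c) + max (delta P) 0 * psi P (c_a c) < mu_low P" by simp
  have **: "delta P * psi P (c_a c) \<le> max (delta P) 0 * psi P (c_a c)"
    using psi_nonneg[OF c(2)] by (intro mult_right_mono) auto
  show ?thesis
    using mu_bounded by eventually_elim (use * ** in \<open>auto simp: Cop_def\<close>)
qed

lemma Cop_nonconst: "\<not> (\<exists>k. AE \<omega> in Prob P. Cop P c \<omega> = k)"
proof
  assume "\<exists>k. AE \<omega> in Prob P. Cop P c \<omega> = k"
  then obtain k where "AE \<omega> in Prob P. Cop P c \<omega> = k" by blast
  then have "AE \<omega> in Prob P. mu P \<omega> = k + phi P (c_e c) + delta P * psi P (c_a c)"
    by eventually_elim (auto simp: Cop_def)
  then show False using mu_nonconst by blast
qed

text \<open>Firm J does not control \<open>c_beta\<close>, so the factor containing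
  \<open>mu P\<close> is common to both contracts and positive. The comparison is therefore free of
  \<open>v\<close>.\<close>

lemma payJ_less_iff:
  assumes v: "0 < v" and c': "c' \<in> devJ s c"
  shows "payJ s P v c < payJ s P v c' \<longleftrightarrow> fixedJ s P c' < fixedJ s P c"
proof -
  let ?E = "expectation (\<lambda>\<omega>. exp (v * (1 - c_beta c) * mu P \<omega>))"
  have b: "c_beta c' = c_beta c" using c' by (simp add: devJ_def)
  have eq: "payJ s P v d = - (exp (v * fixedJ s P d) * ?E)" if "c_beta d = c_beta c" for d
  proof -
    have "(\<lambda>\<omega>. exp (v * lossJ s P d \<omega>)) = (\<lambda>\<omega>. exp (v * fixedJ s P d) * exp (v * (1 - c_beta c) * mu P \<omega>))"
      by (simp add: lossJ_def that distrib_left mult.assoc flip: exp_add)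
    then show ?thesis by (simp add: payJ_lossJ)
  qed
  have "expectation (\<lambda>_. 0) < ?E"
    by (rule integral_less_AE_space)
      (use mu_exp in \<open>auto simp: emeasure_space_1\<close>)
  then have "0 < ?E" by simp
  then show ?thesis
    using v by (simp add: eq[OF b] eq[OF refl])
qed

text \<open>
  Either \<open>J\<close>'s constraint is slack at \<open>v\<close> and a smaller \<open>\<beta>\<close> is cheaper for \<open>I\<close> because
  \<open>C\<^sup>o\<^sup>p > 0\<close>, or \<open>J\<close>'s profit vanishes identically, so \<open>\<beta> = 1\<close> and \<open>I\<close> gains by passing some
  of the risk on to \<open>J\<close>.
\<close>

lemma improving_deviation:
  assumes adm: "admissible c" and vw: "0 < v" "v < w" and w: "- 1 \<le> payJ s P w c"
  obtains c' where "c' \<in> devI s c" "- 1 \<le> payJ s P v c'" "payI s P c < payI s P c'"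
proof (cases "- 1 < payJ s P v c")
  case True
  define c' where "c' b = c\<lparr>c_beta := b\<rparr>" for b
  \<comment> \<open>At \<open>c_beta = 1\<close> the loss is deterministic; lowering it to
    \<open>b\<close> adds the share \<open>1 - b\<close> of the operating cost.\<close>
  define A where "A = fixedJ s P (c' 1)"
  have loss: "lossJ s P (c' b) \<omega> = A + (1 - b) * Cop P c \<omega>" for b \<omega>
    by (simp add: A_def c'_def lossJ_def fixedJ_def Cop_def algebra_simps split: situation.split)
  have "payJ s P v (c' b) = - (exp (v * A) * expectation (\<lambda>\<omega>. exp (v * (1 - b) * Cop P c \<omega>)))" for b
  proof -
    have "(\<lambda>\<omega>. exp (v * lossJ s P (c' b) \<omega>)) = (\<lambda>\<omega>. exp (v * A) * exp (v * (1 - b) * Cop P c \<omega>))"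
      by (simp add: loss distrib_left mult.assoc flip: exp_add)
    then show ?thesis by (simp add: payJ_lossJ)
  qed
  \<comment> \<open>Continuity in \<open>b\<close> lets the slack in firm J's constraint survive a
    small decrease of \<open>c_beta\<close>.\<close>
  moreover have "continuous_on UNIV (\<lambda>b. - (exp (v * A) * expectation (\<lambda>\<omega>. exp (v * (1 - b) * Cop P c \<omega>))))"
    by (intro continuous_intros continuous_on_compose2[OF mgf_continuous[OF exp_moments_Cop]]) auto
  ultimately have "continuous_on UNIV (\<lambda>b. payJ s P v (c' b))" by simp
  then have "((\<lambda>b. payJ s P v (c' b)) \<longlongrightarrow> payJ s P v (c' (c_beta c))) (at_left (c_beta c))"
    by (simp add: continuous_on_def filterlim_at_split)
  moreover have "- 1 < payJ s P v (c' (c_beta c))" using True by (simp add: c'_def)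
  ultimately have "\<forall>\<^sub>F b in at_left (c_beta c). - 1 < payJ s P v (c' b)"
    by (rule order_tendstoD(1))
  moreover have "\<forall>\<^sub>F b in at_left (c_beta c). b < c_beta c" by (simp add: eventually_at_filter)
  ultimately have "\<forall>\<^sub>F b in at_left (c_beta c). - 1 < payJ s P v (c' b) \<and> b < c_beta c"
    by (rule eventually_conj)
  then obtain b where b: "- 1 < payJ s P v (c' b)" "b < c_beta c"
    using eventually_happens'[OF trivial_limit_at_left_real] by blast
  show thesis
  proof (rule that[of "c' b"])
    show "c' b \<in> devI s c" using adm by (simp add: devI_def c'_def admissible_def)
    show "- 1 \<le> payJ s P v (c' b)" using b by simp
    show "payI s P c < payI s P (c' b)"
    proof (rule payI_less)
      show "c_a (c' b) = c_a c" by (simp add: c'_def)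
      show "expectation (\<lambda>\<omega>. exp (uI P * costI P (c' b) \<omega>)) < expectation (\<lambda>\<omega>. exp (uI P * costI P c \<omega>))"
      proof (rule integral_less_AE_space)
        show "AE \<omega> in Prob P. exp (uI P * costI P (c' b) \<omega>) < exp (uI P * costI P c \<omega>)"
          using Cop_pos[OF adm]
        proof eventually_elim
          case (elim \<omega>)
          have "Cop P (c' b) \<omega> = Cop P c \<omega>" by (simp add: Cop_def c'_def)
          then have "costI P (c' b) \<omega> < costI P c \<omega>"
            using elim b(2) by (simp add: costI_def c'_def)
          then show ?case using u_pos by simp
        qed
      qed (use exp_momentsD[OF exp_moments_costI] in \<open>auto simp: emeasure_space_1\<close>)
    qed
  qed
next
  case False
  \<comment> \<open>The moment is at least 1 at \<open>v\<close> and at most 1 at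
    \<open>w > v\<close>, which is the degenerate case of \<open>mgf_less_1\<close>.\<close>
  have loss0: "AE \<omega> in Prob P. lossJ s P c \<omega> = 0"
    using mgf_less_1[OF exp_moments_lossJ vw, of s c] w False by (simp add: payJ_lossJ)
  have beta: "c_beta c = 1"
  proof (rule ccontr)
    assume neq: "c_beta c \<noteq> 1"
    have "AE \<omega> in Prob P. mu P \<omega> = - fixedJ s P c / (1 - c_beta c)"
      using loss0
    proof eventually_elim
      case (elim \<omega>)
      then have "(1 - c_beta c) * mu P \<omega> = - fixedJ s P c" by (simp add: lossJ_def)
      then show ?case using neq by (subst eq_divide_eq) (simp add: mult.commute)
    qed
    then show False using mu_nonconst by blast
  qed
  have fixed: "fixedJ s P c = 0"
    using loss0 beta by (simp add: lossJ_def)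
  obtain \<epsilon> d where \<epsilon>: "0 < \<epsilon>" and d: "0 \<le> d"
    and J: "expectation (\<lambda>\<omega>. exp (v * (\<epsilon> * (Cop P c \<omega> - d)))) \<le> 1"
    and I: "expectation (\<lambda>\<omega>. exp (uI P * (Cop P c \<omega> + \<epsilon> * (d - Cop P c \<omega>))))
      < expectation (\<lambda>\<omega>. exp (uI P * Cop P c \<omega>))"
    using risk_sharing[OF exp_moments_Cop Cop_pos[OF adm] Cop_nonconst u_pos vw(1)] by blast
  \<comment> \<open>Firm J takes over the share \<open>\<epsilon>\<close> of the operating cost for
    a fixed fee at unit price \<open>d\<close>; \<open>0 <= d\<close> keeps \<open>c_alpha\<close>
    admissible.\<close>
  define c' where "c' = c\<lparr>c_beta := 1 - \<epsilon>, c_alpha := c_alpha c + \<epsilon> * d\<rparr>"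
  show thesis
  proof (rule that[of c'])
    show "c' \<in> devI s c" using adm \<epsilon> d by (simp add: devI_def c'_def admissible_def)
    have "lossJ s P c' \<omega> = fixedJ s P c + \<epsilon> * (Cop P c \<omega> - d)" for \<omega>
      using beta by (simp add: c'_def lossJ_def fixedJ_def Cop_def algebra_simps split: situation.split)
    then show "- 1 \<le> payJ s P v c'" using J fixed by (simp add: payJ_lossJ)
    show "payI s P c < payI s P c'"
    proof (rule payI_less)
      show "c_a c' = c_a c" by (simp add: c'_def)
      define k where "k = c_alpha c + c_gamma c * gg P (c_m c) - bm P (c_m c) - be P (c_e c)"
      have c: "(\<lambda>\<omega>. exp (uI P * costI P c \<omega>)) = (\<lambda>\<omega>. exp (uI P * k) * exp (uI P * Cop P c \<omega>))"
        using beta by (simp add: costI_def k_def distrib_left flip: exp_add)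
      have "costI P c' \<omega> = k + (Cop P c \<omega> + \<epsilon> * (d - Cop P c \<omega>))" for \<omega>
        by (simp add: c'_def costI_def k_def Cop_def algebra_simps)
      then have c': "(\<lambda>\<omega>. exp (uI P * costI P c' \<omega>))
          = (\<lambda>\<omega>. exp (uI P * k) * exp (uI P * (Cop P c \<omega> + \<epsilon> * (d - Cop P c \<omega>))))"
        by (simp add: distrib_left[of "uI P" k] flip: exp_add)
      show "expectation (\<lambda>\<omega>. exp (uI P * costI P c' \<omega>)) < expectation (\<lambda>\<omega>. exp (uI P * costI P c \<omega>))"
        unfolding c c' using I by simp
    qed
  qed
qed

section \<open>The acceptance event and the perceived value\<close>

definition acceptance :: "situation \<Rightarrow> ('w \<Rightarrow> real) \<Rightarrow> contract \<Rightarrow> 'w set" where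
  "acceptance s V c = {\<omega> \<in> space (Prob P). payJ s P (V \<omega>) c \<ge> - 1}"

lemma acceptance_events [measurable]:
  assumes "random_variable borel V"
  shows "acceptance s V c \<in> events"
proof -
  have [measurable]: "(\<lambda>v. payJ s P v c) \<in> borel_measurable borel"
    by (rule borel_measurable_continuous_onI[OF payJ_continuous])
  note assms [measurable]
  have "(\<lambda>\<omega>. payJ s P (V \<omega>) c) \<in> borel_measurable (Prob P)" by measurable
  then show ?thesis unfolding acceptance_def by measurable
qed

lemma incomplete_payI_eq:
  assumes "random_variable borel V"
  shows "incomplete_payI s P V p c = incomplete_value p (payI s P c) (prob (acceptance s V c))"
proof -
  have "{\<omega> \<in> space (Prob P). payJ s P (V \<omega>) c < - 1} = space (Prob P) - acceptance s V c"
    by (auto simp: acceptance_def)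
  then show ?thesis
    using prob_compl[OF acceptance_events[OF assms, of s c]]
    by (simp add: incomplete_payI_def incomplete_value_def acceptance_def)
qed

end

section \<open>Equilibrium conditions and the threshold risk aversion\<close>

theorem theorem9:
  fixes P :: "'w model" and s :: situation and V :: "'w \<Rightarrow> real" and p :: ereal
    and vJ :: real and c :: contract
  assumes "outsourcing_model P"
    and "AE \<omega> in Prob P. 0 < V \<omega>"
    and "prob_space.indep_var (Prob P) borel (mu P) borel V"
    and "p \<noteq> -\<infinity>"
    and "0 < vJ"
    and "nash_incomplete s P V p vJ c"
    and "incomplete_payI s P V p c > - p"
  shows "v_hat s P c > 0
    \<and> c_e c = deriv_inv (phi P) (1 / ereal (max (1 - c_beta c) 0))
    \<and> ereal (c_gamma c) = 1 / ederiv (gg P) (c_m c)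
    \<and> (s = Situation1 \<longrightarrow>
         c_a c = deriv_inv (psi P)
                   (ereal (1 + rJ P) / ereal (max (delta P * (1 - c_beta c)) 0)))
    \<and> (v_hat s P c < \<infinity> \<longrightarrow>
         nash_complete s P (real_of_ereal (v_hat s P c)) c
         \<and> (\<forall>v::real. ereal v < v_hat s P c \<longrightarrow>
              measure (Prob P) {\<omega> \<in> space (Prob P). V \<omega> \<le> v}
              < measure (Prob P) {\<omega> \<in> space (Prob P). ereal (V \<omega>) \<le> v_hat s P c}))
    \<and> (v_hat s P c = \<infinity> \<longrightarrow>
         (\<forall>v::real. 0 < v \<longrightarrow> measure (Prob P) {\<omega> \<in> space (Prob P). V \<omega> \<le> v} < 1))"
proof -
  interpret outsourcing_model P by fact
  have V [measurable]: "random_variable borel V"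
    using indep_var_rv2[OF assms(3)] .
  note p = \<open>p \<noteq> -\<infinity>\<close>
  let ?A = "\<lambda>c. prob (acceptance s V c)"
  have cJ: "c \<in> devJ s c" "\<And>d. d \<in> devJ s c \<Longrightarrow> \<not> payJ s P vJ c < payJ s P vJ d"
    and cI: "c \<in> devI s c"
      "\<And>d. d \<in> devI s c \<Longrightarrow> \<not> incomplete_payI s P V p c < incomplete_payI s P V p d"
    using \<open>nash_incomplete s P V p vJ c\<close> unfolding nash_incomplete_def is_arg_max_def by blast+
  have adm: "admissible c" using cJ by (simp add: devJ_def)
  have val: "incomplete_value p (payI s P c) (?A c) > - p"
    using assms(7) by (simp add: incomplete_payI_eq[OF V])
  have A_pos: "0 < ?A c"
    using incomplete_value_gt_penalty[OF p val] by (simp add: zero_less_measure_iff)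
  \<comment> \<open>A deviation with a larger payoff and no smaller acceptance probability would
    raise the perceived value.\<close>
  have payI_max: "payI s P d \<le> payI s P c" if "d \<in> devI s c" "?A c \<le> ?A d" for d
    using incomplete_value_improves[OF p val _ that(2)] cI(2)[OF that(1)]
    by (force simp: incomplete_payI_eq[OF V] not_less)
  \<comment> \<open>Optimality at \<open>vJ\<close> becomes minimality of \<open>fixedJ\<close>,
    which in turn gives optimality at every positive risk aversion.\<close>
  have fixed_max: "fixedJ s P c \<le> fixedJ s P d" if "d \<in> devJ s c" for d
    using payJ_less_iff[OF \<open>0 < vJ\<close> that] cJ(2)[OF that] by simp
  have J_max: "is_arg_max (payJ s P v) (\<lambda>d. d \<in> devJ s c) c" if "0 < v" for v
    unfolding is_arg_max_def using cJ(1) fixed_max payJ_less_iff[OF that] by (meson leD)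
  have below: "- 1 \<le> payJ s P v c" if v: "0 < v" "ereal v < v_hat s P c" for v
  proof -
    obtain w where "0 < w" "- payJ s P w c \<le> 1" "v < w"
      using v(2) unfolding v_hat_def less_SUP_iff by auto
    then show ?thesis using payJ_ge_antimono[of v w s c] v by simp
  qed
  have le_v_hat: "ereal v \<le> v_hat s P c" if "0 < v" "- 1 \<le> payJ s P v c" for v
    unfolding v_hat_def by (rule SUP_upper) (use that in auto)

  have v_hat_pos: "0 < v_hat s P c"
  proof (rule ccontr)
    assume "\<not> ?thesis"
    \<comment> \<open>If no positive risk aversion accepts, the acceptance event is null because
      \<open>V\<close> is almost surely positive.\<close>
    then have "\<not> - 1 \<le> payJ s P v c" if "0 < v" for v
      using le_v_hat[OF that] that by (meson ereal_less(2) leD le_less_trans not_less)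
    then have "AE \<omega> in Prob P. \<omega> \<notin> acceptance s V c"
      using assms(2) by (auto elim!: eventually_mono simp: acceptance_def)
    then have "?A c = 0"
      by (intro measure_eq_0_null_sets) (simp add: AE_iff_null_sets)
    then show False using A_pos by simp
  qed

  have e: "c_e c = deriv_inv (phi P) (1 / ereal (max (1 - c_beta c) 0))"
  proof -
    have "(1 - c_beta c) * phi P y - 1 * y \<le> (1 - c_beta c) * phi P (c_e c) - 1 * c_e c" if "0 \<le> y" for y
      using fixed_max[of "c\<lparr>c_e := y\<rparr>"] adm that
      by (simp add: devJ_def admissible_def fixedJ_def split: situation.splits)
    from linear_cost_argmax_deriv_inv[OF phi_C1 phi_concave phi_mono phi_deriv_0 _ _ this]
    show ?thesis using adm by (simp add: admissible_def one_ereal_def)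
  qed
  have \<gamma>: "ereal (c_gamma c) = 1 / ederiv (gg P) (c_m c)"
  proof -
    have "c_gamma c * gg P y - 1 * y \<le> c_gamma c * gg P (c_m c) - 1 * c_m c" if "0 \<le> y" for y
      using fixed_max[of "c\<lparr>c_m := y\<rparr>"] adm that
      by (simp add: devJ_def admissible_def fixedJ_def split: situation.splits)
    from linear_cost_argmax[OF g_C1 g_mono g_deriv_0 _ _ this]
    \<comment> \<open>In the first alternative \<open>c_gamma c\<close> and \<open>c_m c\<close> are
      both 0, which agrees with 1 divided by the infinite slope at 0.\<close>
    have "(c_gamma c \<le> 0 \<and> c_m c = 0) \<or> (0 < c_gamma c \<and> ederiv (gg P) (c_m c) = ereal (1 / c_gamma c))"
      using adm by (auto simp: admissible_def)
    then show ?thesis using adm g_deriv_0 by (auto simp: admissible_def one_ereal_def)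
  qed
  have a: "c_a c = deriv_inv (psi P) (ereal (1 + rJ P) / ereal (max (delta P * (1 - c_beta c)) 0))"
    if s: "s = Situation1"
  proof -
    have "delta P * (1 - c_beta c) * psi P y - (1 + rJ P) * y
        \<le> delta P * (1 - c_beta c) * psi P (c_a c) - (1 + rJ P) * c_a c" if "0 \<le> y" for y
      using fixed_max[of "c\<lparr>c_a := y\<rparr>"] adm that
      by (simp add: s devJ_def admissible_def fixedJ_def algebra_simps)
    from linear_cost_argmax_deriv_inv[OF psi_C1 psi_concave psi_mono psi_deriv_0 _ _ this]
    show ?thesis using adm rJ_nonneg by (simp add: admissible_def)
  qed

  have cdf_less: "prob {\<omega> \<in> space (Prob P). V \<omega> \<le> v} < ?A c" if v: "ereal v < v_hat s P c" for v
  proof (cases "0 < v")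
    case True
    \<comment> \<open>An accepted \<open>w\<close> strictly above \<open>v\<close> is the slack that
      \<open>improving_deviation\<close> exploits.\<close>
    obtain w where w: "v < w" "ereal w < v_hat s P c" using ereal_dense2[OF v] by auto
    obtain d where d: "d \<in> devI s c" "- 1 \<le> payJ s P v d" "payI s P c < payI s P d"
      using improving_deviation[OF adm True w(1) below[OF _ w(2)]] True w(1) by auto
    \<comment> \<open>All risk aversions up to \<open>v\<close> accept the better contract
      \<open>d\<close>. If they were as likely as acceptance of \<open>c\<close>, then
      \<open>payI_max\<close> would fail.\<close>
    have "prob {\<omega> \<in> space (Prob P). V \<omega> \<le> v} \<le> ?A d"
    proof (rule finite_measure_mono_AE)
      show "AE \<omega> in Prob P. \<omega> \<in> {\<omega> \<in> space (Prob P). V \<omega> \<le> v} \<longrightarrow> \<omega> \<in> acceptance s V d"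
        using assms(2) by eventually_elim (use payJ_ge_antimono d(2) in \<open>auto simp: acceptance_def\<close>)
    qed (rule acceptance_events[OF V])
    then show ?thesis using payI_max[OF d(1)] d(3) by linarith
  next
    case False
    have "AE \<omega> in Prob P. \<omega> \<notin> {\<omega> \<in> space (Prob P). V \<omega> \<le> v}"
      using assms(2) by eventually_elim (use False in auto)
    then have "prob {\<omega> \<in> space (Prob P). V \<omega> \<le> v} \<le> prob {}"
      by (intro finite_measure_mono_AE) (auto elim!: eventually_mono)
    then show ?thesis using A_pos by simp
  qed

  have complete: "nash_complete s P (real_of_ereal (v_hat s P c)) c
      \<and> (\<forall>v::real. ereal v < v_hat s P c \<longrightarrow>
          prob {\<omega> \<in> space (Prob P). V \<omega> \<le> v} < prob {\<omega> \<in> space (Prob P). ereal (V \<omega>) \<le> v_hat s P c})"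
    if fin: "v_hat s P c < \<infinity>"
  proof -
    obtain r where r: "v_hat s P c = ereal r" using fin v_hat_pos by (cases "v_hat s P c") auto
    have r0: "0 < r" using v_hat_pos r by simp
    \<comment> \<open>The threshold itself accepts, by continuity from the left.\<close>
    have "((\<lambda>v. payJ s P v c) \<longlongrightarrow> payJ s P r c) (at_left r)"
      using payJ_continuous[of s c] by (simp add: continuous_on_def filterlim_at_split)
    moreover have "\<forall>\<^sub>F v in at_left r. - 1 \<le> payJ s P v c"
      using eventually_at_left_real[OF r0] by eventually_elim (use below r in auto)
    ultimately have Jr: "- 1 \<le> payJ s P r c"
      by (rule tendsto_lowerbound) simp
    have acc: "AE \<omega> in Prob P. \<omega> \<in> acceptance s V c \<longrightarrow> V \<omega> \<le> r"
      using assms(2) by eventually_elim (use le_v_hat r in \<open>auto simp: acceptance_def\<close>)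
    have "\<not> payI s P c < payI s P d" if d: "d \<in> devI s c" "- 1 \<le> payJ s P r d" for d
    proof -
      \<comment> \<open>Almost surely \<open>c\<close> is accepted only when \<open>V\<close> is at
        most \<open>r\<close>, and all such risk aversions accept \<open>d\<close>.\<close>
      have "?A c \<le> ?A d"
      proof (rule finite_measure_mono_AE)
        show "AE \<omega> in Prob P. \<omega> \<in> acceptance s V c \<longrightarrow> \<omega> \<in> acceptance s V d"
          using acc assms(2)
          by eventually_elim (use payJ_ge_antimono[OF _ _ d(2)] in \<open>auto simp: acceptance_def\<close>)
      qed (rule acceptance_events[OF V])
      then show ?thesis using payI_max[OF d(1)] by simp
    qed
    then have "nash_complete s P r c"
      unfolding nash_complete_def using J_max[OF r0] Jr cI(1) by (auto simp: is_arg_max_def)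
    moreover have "?A c \<le> prob {\<omega> \<in> space (Prob P). ereal (V \<omega>) \<le> v_hat s P c}"
    proof (rule finite_measure_mono_AE)
      show "AE \<omega> in Prob P. \<omega> \<in> acceptance s V c \<longrightarrow> \<omega> \<in> {\<omega> \<in> space (Prob P). ereal (V \<omega>) \<le> v_hat s P c}"
        using acc by eventually_elim (use r in \<open>auto simp: acceptance_def\<close>)
    qed measurable
    ultimately show ?thesis using cdf_less r by (force intro: less_le_trans)
  qed
  \<comment> \<open>Here every \<open>v\<close> lies below the threshold, and an acceptance
    probability is at most 1.\<close>
  have "prob {\<omega> \<in> space (Prob P). V \<omega> \<le> v} < 1" if "v_hat s P c = \<infinity>" for v
    by (rule less_le_trans[OF cdf_less prob_le_1]) (simp add: that)
  then show ?thesis using v_hat_pos e \<gamma> a complete by blast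
qed

end
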